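(* Let $x\in\left(0,\sum_{i=1}^n \bar v_i\right)$, and assume that for every $i=1,\dots,n$ the function $w_i$ is in $C^2(0,\infty)$ and strictly concave. Let $\alpha_x$ be the unique $\alpha\in(0,\infty)$ such that $x\in[\hat x(\alpha),\check x(\alpha)]$. Then the social optimum line flows for the demand $x$ are given as follows: a vector $v=(v_1,\dots,v_n)$ with $v_i\in[0,\bar v_i)$ and $\sum_{i=1}^n v_i=x$ is a social optimum line-flow vector if and only if, for every $i=1,\dots,n$, $$v_i=\begin{cases}0 & \text{if } t_i>\bar\lambda(\alpha_x),\\ w_i(\alpha_x) & \text{if } t_i<\bar\lambda(\alpha_x),\end{cases}\qquad\text{and}\qquad 0\le v_i\le w_i(\alpha_x)\ \text{ if } t_i=\bar\lambda(\alpha_x).$$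
   Context: An origin is connected to a destination by $n$ bus lines $1,\dots,n$. Line $i$ has a constant in-vehicle travel time $t_i\ge 0$, a saturation flow $\bar v_i\in(0,\infty]$, and a smooth effective frequency function $f_i:[0,\bar v_i)\to(0,\infty)$ with $f_i'(v)<0$ for all $v$ and $f_i(v)\to 0$ as $v\to\bar v_i$. The function $w_i:[0,\infty)\to[0,\bar v_i)$ is the inverse of the strictly increasing function $v\mapsto v/f_i(v)$ (it is differentiable with $w_i'>0$ on $(0,\infty)$). Strategies and social optimum. $\mathcal S$ is the set of nonempty subsets of $\{1,\dots,n\}$ (strategies). A strategy-flow vector $h=(h_s)_{s\in\mathcal S}\ge 0$ induces a unique line-flow vector $v=v(h)$, $v_i\in[0,\bar v_i)$, through the system $v_i=\sum_{s\ni i}h_s\,\frac{f_i(v_i)}{\sum_{j\in s}f_j(v_j)}$, $i=1,\dots,n$ (only those $h$ for which this system is solvable are considered). The expected transit time of $s$ is $T_s(v)=\frac{1+\sum_{i\in s}t_if_i(v_i)}{\sum_{i\in s}f_i(v_i)}$. For demand $x$, a social optimum is an $h$ minimising $\sum_{s\in\mathcal S}h_sT_s(v(h))$ over all $h\ge0$ with $\sum_{s\in\mathcal S}h_s=x$. A social optimum line-flow vector is a vector of the form $v(h)$ with $h$ a social optimum. Auxiliary functions. Write $(y)_+=\max(y,0)$. For $\alpha>0$ and $\lambda\in\mathbb R$ let $\psi_\alpha(\lambda)=\sum_{i=1}^n(\lambda-t_i)_+\,w_i'(\alpha)$. For each $\alpha>0$ the equation $\psi_\alpha(\lambda)=1$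 has a unique solution $\lambda$, denoted $\bar\lambda(\alpha)$. Define, for $\alpha>0$, $\hat x(\alpha)=\sum_{i:\,t_i<\bar\lambda(\alpha)}w_i(\alpha)$ and $\check x(\alpha)=\sum_{i:\,t_i\le\bar\lambda(\alpha)}w_i(\alpha)$. Under the hypotheses, for each $x\in(0,\sum_i\bar v_i)$ there is exactly one $\alpha>0$ with $x\in[\hat x(\alpha),\check x(\alpha)]$. *)

theory Defs
  imports "HOL-Analysis.Analysis"
begin

text \<open>Lines are the elements of a finite type \<open>'n\<close>.  A saturation flow is an \<open>ereal\<close>, so that
  the value \<open>\<infinity>\<close> is allowed.\<close>

definition flow_range :: "ereal \<Rightarrow> real set" where
  "flow_range vb = {v. 0 \<le> v \<and> ereal v < vb}"

text \<open>Smoothness is continuous differentiability on the half-open range, one-sided at \<open>0\<close>.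
  The limit at the saturation flow is taken in \<open>ereal\<close>, which covers finite and infinite \<open>vb\<close>
  at once.\<close>

definition effective_frequency :: "ereal \<Rightarrow> (real \<Rightarrow> real) \<Rightarrow> bool" where
  "effective_frequency vb f \<longleftrightarrow>
     (\<forall>v\<in>flow_range vb. 0 < f v) \<and>
     (\<exists>f'. continuous_on (flow_range vb) f' \<and>
        (\<forall>v\<in>flow_range vb.
           (f has_real_derivative f' v) (at v within flow_range vb) \<and> f' v < 0)) \<and>
     ((f \<circ> real_of_ereal) \<longlongrightarrow> 0) (at_left vb)"

definition inv_flow :: "ereal \<Rightarrow> (real \<Rightarrow> real) \<Rightarrow> real \<Rightarrow> real" where
  "inv_flow vb f = inv_into (flow_range vb) (\<lambda>v. v / f v)"

definition C2_on :: "real set \<Rightarrow> (real \<Rightarrow> real) \<Rightarrow> bool" where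
  "C2_on S g \<longleftrightarrow> (\<forall>x\<in>S. g differentiable (at x)) \<and> deriv g C1_differentiable_on S"

definition strictly_concave_on :: "real set \<Rightarrow> (real \<Rightarrow> real) \<Rightarrow> bool" where
  "strictly_concave_on S g \<longleftrightarrow> convex S \<and>
     (\<forall>x\<in>S. \<forall>y\<in>S. \<forall>u. x \<noteq> y \<and> 0 < u \<and> u < 1 \<longrightarrow>
        (1 - u) * g x + u * g y < g ((1 - u) * x + u * y))"

definition strategies :: "'n::finite set set" where
  "strategies = {s. s \<noteq> {}}"

text \<open>A strategy-flow vector is a function on all sets of lines; its value at \<open>{}\<close> is never used.\<close>

definition induces_line_flow ::
    "('n::finite \<Rightarrow> ereal) \<Rightarrow> ('n \<Rightarrow> real \<Rightarrow> real) \<Rightarrow> ('n set \<Rightarrow> real) \<Rightarrow> ('n \<Rightarrow> real) \<Rightarrow> bool" where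
  "induces_line_flow vb f h v \<longleftrightarrow>
     (\<forall>i. v i \<in> flow_range (vb i) \<and>
        v i = (\<Sum>s\<in>{s\<in>strategies. i \<in> s}. h s * (f i (v i) / (\<Sum>j\<in>s. f j (v j)))))"

definition line_flow ::
    "('n::finite \<Rightarrow> ereal) \<Rightarrow> ('n \<Rightarrow> real \<Rightarrow> real) \<Rightarrow> ('n set \<Rightarrow> real) \<Rightarrow> 'n \<Rightarrow> real" where
  "line_flow vb f h = (THE v. induces_line_flow vb f h v)"

definition transit_time ::
    "('n::finite \<Rightarrow> real) \<Rightarrow> ('n \<Rightarrow> real \<Rightarrow> real) \<Rightarrow> 'n set \<Rightarrow> ('n \<Rightarrow> real) \<Rightarrow> real" where
  "transit_time t f s v = (1 + (\<Sum>i\<in>s. t i * f i (v i))) / (\<Sum>i\<in>s. f i (v i))"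

definition total_cost ::
    "('n::finite \<Rightarrow> real) \<Rightarrow> ('n \<Rightarrow> ereal) \<Rightarrow> ('n \<Rightarrow> real \<Rightarrow> real) \<Rightarrow> ('n set \<Rightarrow> real) \<Rightarrow> real" where
  "total_cost t vb f h = (\<Sum>s\<in>strategies. h s * transit_time t f s (line_flow vb f h))"

definition feasible ::
    "('n::finite \<Rightarrow> ereal) \<Rightarrow> ('n \<Rightarrow> real \<Rightarrow> real) \<Rightarrow> real \<Rightarrow> ('n set \<Rightarrow> real) \<Rightarrow> bool" where
  "feasible vb f x h \<longleftrightarrow>
     (\<forall>s\<in>strategies. 0 \<le> h s) \<and> (\<Sum>s\<in>strategies. h s) = x \<and> (\<exists>v. induces_line_flow vb f h v)"

definition social_optimum ::
    "('n::finite \<Rightarrow> real) \<Rightarrow> ('n \<Rightarrow> ereal) \<Rightarrow> ('n \<Rightarrow> real \<Rightarrow> real) \<Rightarrow> real \<Rightarrow> ('n set \<Rightarrow> real) \<Rightarrow> bool" where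
  "social_optimum t vb f x h \<longleftrightarrow>
     feasible vb f x h \<and> (\<forall>h'. feasible vb f x h' \<longrightarrow> total_cost t vb f h \<le> total_cost t vb f h')"

definition social_optimum_line_flow ::
    "('n::finite \<Rightarrow> real) \<Rightarrow> ('n \<Rightarrow> ereal) \<Rightarrow> ('n \<Rightarrow> real \<Rightarrow> real) \<Rightarrow> real \<Rightarrow> ('n \<Rightarrow> real) \<Rightarrow> bool" where
  "social_optimum_line_flow t vb f x v \<longleftrightarrow> (\<exists>h. social_optimum t vb f x h \<and> v = line_flow vb f h)"

text \<open>In what follows \<open>w i\<close> stands for \<open>inv_flow (vb i) (f i)\<close>.\<close>

definition psi ::
    "('n::finite \<Rightarrow> real) \<Rightarrow> ('n \<Rightarrow> real \<Rightarrow> real) \<Rightarrow> real \<Rightarrow> real \<Rightarrow> real" where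
  "psi t w \<alpha> l = (\<Sum>i\<in>UNIV. max (l - t i) 0 * deriv (w i) \<alpha>)"

definition lambda_bar ::
    "('n::finite \<Rightarrow> real) \<Rightarrow> ('n \<Rightarrow> real \<Rightarrow> real) \<Rightarrow> real \<Rightarrow> real" where
  "lambda_bar t w \<alpha> = (THE l. psi t w \<alpha> l = 1)"

definition x_hat ::
    "('n::finite \<Rightarrow> real) \<Rightarrow> ('n \<Rightarrow> real \<Rightarrow> real) \<Rightarrow> real \<Rightarrow> real" where
  "x_hat t w \<alpha> = (\<Sum>i | t i < lambda_bar t w \<alpha>. w i \<alpha>)"

definition x_check ::
    "('n::finite \<Rightarrow> real) \<Rightarrow> ('n \<Rightarrow> real \<Rightarrow> real) \<Rightarrow> real \<Rightarrow> real" where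
  "x_check t w \<alpha> = (\<Sum>i | t i \<le> lambda_bar t w \<alpha>. w i \<alpha>)"

definition alpha_of ::
    "('n::finite \<Rightarrow> real) \<Rightarrow> ('n \<Rightarrow> real \<Rightarrow> real) \<Rightarrow> real \<Rightarrow> real" where
  "alpha_of t w x = (THE \<alpha>. 0 < \<alpha> \<and> x \<in> {x_hat t w \<alpha>..x_check t w \<alpha>})"

end

theory Submission
  imports Defs
begin

text \<open>If \<open>h\<close> induces \<open>v\<close>, its cost is \<open>\<Sum>i. t i * v i\<close> plus the expected wait
  \<open>W = \<Sum>s. h s / (\<Sum>j\<in>s. f j (v j))\<close>, and \<open>v i / f i (v i) \<le> W\<close>, that is \<open>v i \<le> w i W\<close>;
  conversely, nested strategies reach \<open>W = max v i / f i (v i)\<close>.  The problem is thus to minimise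
  \<open>\<Sum>i. t i * v i + \<alpha>\<close> subject to \<open>0 \<le> v i \<le> w i \<alpha>\<close> and \<open>\<Sum>i. v i = x\<close>.  As the \<open>w i\<close> are strictly
  concave, Lagrangian duality applies with multiplier \<open>\<lambda>\<close> for the demand constraint:
  minimising over \<open>v\<close> leaves \<open>\<lambda> * x + \<alpha> - \<Sum>i. max (\<lambda> - t i) 0 * w i \<alpha>\<close>, which is stationary in
  \<open>\<alpha>\<close> exactly when \<open>\<lambda> = lambda_bar t w \<alpha>\<close>.\<close>

subsection \<open>The inverse flow functions\<close>

lemma flow_rangeD: "v \<in> flow_range vb \<Longrightarrow> 0 \<le> v"
  by (simp add: flow_range_def)

lemma flow_range_downward: "v \<in> flow_range vb \<Longrightarrow> 0 \<le> u \<Longrightarrow> u \<le> v \<Longrightarrow> u \<in> flow_range vb"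
  unfolding flow_range_def by (auto intro: le_less_trans[of "ereal u" "ereal v"])

lemma effective_frequency_pos:
  "effective_frequency vb f \<Longrightarrow> v \<in> flow_range vb \<Longrightarrow> 0 < f v"
  by (simp add: effective_frequency_def)

lemma effective_frequency_continuous:
  assumes "effective_frequency vb f"
  shows "continuous_on (flow_range vb) f"
proof -
  obtain f' where "\<forall>v\<in>flow_range vb. (f has_real_derivative f' v) (at v within flow_range vb)"
    using assms unfolding effective_frequency_def by blast
  then show ?thesis
    by (meson DERIV_continuous_on)
qed

lemma effective_frequency_strict_antimono:
  assumes f: "effective_frequency vb f"
    and u: "u \<in> flow_range vb" and v: "v \<in> flow_range vb" and "u < v"
  shows "f v < f u"
proof -
  obtain f' where f': "\<And>v. v \<in> flow_range vb \<Longrightarrow>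
      (f has_real_derivative f' v) (at v within flow_range vb) \<and> f' v < 0"
    using f unfolding effective_frequency_def by blast
  have sub: "{u..v} \<subseteq> flow_range vb"
    using flow_range_downward[OF v] flow_rangeD[OF u] by auto
  show ?thesis
  \<comment> \<open>At \<open>u = 0\<close> the derivative is only one-sided, so the criterion used
    asks for continuity on \<open>{u..v}\<close> and for two-sided derivatives in the interior
    alone.\<close>
  proof (rule DERIV_neg_imp_decreasing_open[OF \<open>u < v\<close>])
    show "continuous_on {u..v} f"
      using effective_frequency_continuous[OF f] sub by (rule continuous_on_subset)
    fix y assume y: "u < y" "y < v"
    then have yr: "y \<in> flow_range vb" using sub by auto
    have "(f has_real_derivative f' y) (at y within {u<..<v})"
      by (rule DERIV_subset[OF conjunct1[OF f'[OF yr]]]) (use sub in auto)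
    then have "(f has_real_derivative f' y) (at y)"
      using y at_within_open[of y "{u<..<v}"] by simp
    then show "\<exists>z. (f has_real_derivative z) (at y) \<and> z < 0"
      using f'[OF yr] by blast
  qed
qed

lemma effective_frequency_small:
  assumes f: "effective_frequency vb f" and u: "u \<in> flow_range vb" and "0 < e"
  obtains v where "v \<in> flow_range vb" "u \<le> v" "f v < e"
proof -
  have u': "ereal u < vb" "0 \<le> u" using u by (auto simp: flow_range_def)
  have "((f \<circ> real_of_ereal) \<longlongrightarrow> 0) (at_left vb)"
    using f by (simp add: effective_frequency_def)
  then have "\<forall>\<^sub>F y in at_left vb. (f \<circ> real_of_ereal) y < e"
    using \<open>0 < e\<close> by (rule order_tendstoD(2))
  then obtain b where b: "b < vb" "\<And>y. b < y \<Longrightarrow> y < vb \<Longrightarrow> f (real_of_ereal y) < e"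
    using u'(1) by (auto simp: eventually_at_left)
  have "max b (ereal u) < vb" using b(1) u'(1) by simp
  then obtain v where v: "max b (ereal u) < ereal v" "ereal v < vb"
    using ereal_dense2 by blast
  have "u \<le> v" using v(1) by simp
  moreover have "f v < e" using b(2)[of "ereal v"] v by simp
  moreover have "v \<in> flow_range vb" using v u' by (simp add: flow_range_def)
  ultimately show thesis using that by blast
qed

lemma flow_ratio_strict_mono:
  assumes f: "effective_frequency vb f"
  shows "strict_mono_on (flow_range vb) (\<lambda>v. v / f v)"
proof (rule strict_mono_onI)
  fix u v assume uv: "u \<in> flow_range vb" "v \<in> flow_range vb" "u < v"
  have "0 < f u" "0 < f v" "f v < f u" "0 \<le> u"
    using uv f effective_frequency_pos effective_frequency_strict_antimono flow_rangeD by blast+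
  then have "u / f u \<le> u / f v" by (intro divide_left_mono) auto
  also have "\<dots> < v / f v" using \<open>0 < f v\<close> \<open>u < v\<close> by (rule divide_strict_right_mono[rotated])
  finally show "u / f u < v / f v" .
qed

lemma zero_in_flow_range: "0 < vb \<Longrightarrow> 0 \<in> flow_range vb"
  unfolding flow_range_def zero_ereal_def by simp

text \<open>Intermediate values: the ratio is 0 at flow 0 and becomes arbitrarily large, because
  \<open>f\<close> tends to 0 while the flow can be kept at least some \<open>u > 0\<close>.\<close>

lemma flow_ratio_surj:
  assumes f: "effective_frequency vb f" and vb: "0 < vb" and a: "0 \<le> a"
  shows "a \<in> (\<lambda>v. v / f v) ` flow_range vb"
proof -
  obtain u where u: "ereal u < vb" "0 < u"
    using ereal_dense2[OF vb] by auto
  then have ur: "u \<in> flow_range vb" by (simp add: flow_range_def)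
  \<comment> \<open>With \<open>v \<ge> u\<close>, a frequency below this bound pushes
    \<open>v / f v\<close> above \<open>a\<close>; the added 1 keeps the divisor positive at
    \<open>a = 0\<close>.\<close>
  have "0 < u / (a + 1)" using u a by simp
  then obtain v where v: "v \<in> flow_range vb" "u \<le> v" "f v < u / (a + 1)"
    using effective_frequency_small[OF f ur] by metis
  have fv: "0 < f v" using effective_frequency_pos[OF f v(1)] .
  have "a * f v \<le> (a + 1) * f v" using fv by simp
  also have "\<dots> \<le> u" using v(3) a by (simp add: field_simps)
  finally have "a \<le> v / f v" using fv v(2) by (simp add: field_simps)
  moreover have "continuous_on {0..v} (\<lambda>v. v / f v)"
  proof (intro continuous_on_divide continuous_on_id)
    have sub: "{0..v} \<subseteq> flow_range vb" using flow_range_downward[OF v(1)] by auto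
    then show "continuous_on {0..v} f"
      using effective_frequency_continuous[OF f] continuous_on_subset by blast
    show "\<forall>y\<in>{0..v}. f y \<noteq> 0" using sub effective_frequency_pos[OF f] by force
  qed
  ultimately obtain y where "0 \<le> y" "y \<le> v" "y / f y = a"
    using IVT'[of "\<lambda>v. v / f v" 0 a v] a flow_rangeD[OF v(1)] by auto
  then show ?thesis using flow_range_downward[OF v(1)] by blast
qed

context
  fixes vb :: ereal and f :: "real \<Rightarrow> real"
  assumes f: "effective_frequency vb f" and vb: "0 < vb"
begin

lemma inv_flow_in_range: "0 \<le> a \<Longrightarrow> inv_flow vb f a \<in> flow_range vb"
  unfolding inv_flow_def by (rule inv_into_into[OF flow_ratio_surj[OF f vb]])

lemma flow_ratio_inv_flow: "0 \<le> a \<Longrightarrow> inv_flow vb f a / f (inv_flow vb f a) = a"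
  unfolding inv_flow_def using f_inv_into_f[OF flow_ratio_surj[OF f vb]] by simp

lemma inv_flow_nonneg: "0 \<le> a \<Longrightarrow> 0 \<le> inv_flow vb f a"
  using inv_flow_in_range flow_rangeD by blast

text \<open>Monotonicity of the ratio lets a bound on waiting be read as a capacity bound on the
  flow, and back.\<close>

lemma le_inv_flow_iff:
  assumes "v \<in> flow_range vb" "0 \<le> a"
  shows "v \<le> inv_flow vb f a \<longleftrightarrow> v / f v \<le> a"
  using strict_mono_on_less_eq[OF flow_ratio_strict_mono[OF f] assms(1) inv_flow_in_range[OF assms(2)]]
    flow_ratio_inv_flow[OF assms(2)] by simp

lemma inv_flow_strict_mono:
  assumes "0 \<le> a" "a < b"
  shows "inv_flow vb f a < inv_flow vb f b"
proof -
  have b: "0 \<le> b" using assms by simp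
  show ?thesis
    using strict_mono_on_less[OF flow_ratio_strict_mono[OF f]
        inv_flow_in_range[OF assms(1)] inv_flow_in_range[OF b]]
      flow_ratio_inv_flow[OF assms(1)] flow_ratio_inv_flow[OF b] assms(2) by simp
qed

lemma inv_flow_eq: "0 \<le> a \<Longrightarrow> inv_flow vb f a = a * f (inv_flow vb f a)"
  using flow_ratio_inv_flow[of a] effective_frequency_pos[OF f inv_flow_in_range[of a]]
  by (metis less_irrefl nonzero_divide_eq_eq)

text \<open>With \<open>w = inv_flow vb f\<close>, one has \<open>w a = a * f (w a)\<close>, and
  \<open>f\<close> is largest at 0. The bound later yields the limit 0 of \<open>w\<close> at
  0.\<close>

lemma inv_flow_le_linear: "0 \<le> a \<Longrightarrow> inv_flow vb f a \<le> a * f 0"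
proof -
  assume a: "0 \<le> a"
  have "f (inv_flow vb f a) \<le> f 0"
    using effective_frequency_strict_antimono[OF f zero_in_flow_range[OF vb] inv_flow_in_range[OF a]]
      inv_flow_nonneg[OF a] by (cases "inv_flow vb f a = 0") auto
  then have "a * f (inv_flow vb f a) \<le> a * f 0" using a by (rule mult_left_mono)
  then show ?thesis using inv_flow_eq[OF a] by linarith
qed

lemma eventually_inv_flow_ge:
  assumes v: "v \<in> flow_range vb"
  shows "\<forall>\<^sub>F a in at_top. v \<le> inv_flow vb f a"
  using eventually_ge_at_top[of "max 0 (v / f v)"]
  by eventually_elim (simp add: le_inv_flow_iff[OF v])

text \<open>The quotient \<open>w a / a\<close> equals \<open>f (w a)\<close>, and
  \<open>w a\<close> eventually passes a flow at which \<open>f\<close> is below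
  \<open>e\<close>.\<close>

lemma eventually_inv_flow_sublinear:
  assumes "0 < e"
  shows "\<forall>\<^sub>F a in at_top. inv_flow vb f a < e * a"
proof -
  obtain v where v: "v \<in> flow_range vb" "f v < e"
    using effective_frequency_small[OF f zero_in_flow_range[OF vb] assms] by metis
  show ?thesis
    using eventually_inv_flow_ge[OF v(1)] eventually_gt_at_top[of 0]
  proof eventually_elim
    case (elim a)
    then have "f (inv_flow vb f a) \<le> f v"
      using effective_frequency_strict_antimono[OF f v(1) inv_flow_in_range[of a]]
      by (cases "inv_flow vb f a = v") auto
    then have "a * f (inv_flow vb f a) < a * e" using elim v(2) by simp
    then show ?case using inv_flow_eq[of a] elim by (simp add: mult.commute)
  qed
qed

end

text \<open>Convexity of \<open>- g\<close> gives the weak inequality. If it were an equality at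
  \<open>b\<close>, strict concavity would lift the midpoint of \<open>a\<close> and
  \<open>b\<close> above the tangent.\<close>

lemma strictly_concave_below_tangent:
  fixes g :: "real \<Rightarrow> real"
  assumes g: "strictly_concave_on {0..} g" and d: "(g has_real_derivative D) (at a)"
    and a: "0 < a" and b: "0 \<le> b" and "b \<noteq> a"
  shows "g b < g a + D * (b - a)"
proof -
  have conv: "convex_on {0..} (\<lambda>x. - g x)"
  proof (rule convex_onI)
    fix u x y :: real assume u: "0 < u" "u < 1" and xy: "x \<in> {0..}" "y \<in> {0..}"
    show "- g ((1 - u) *\<^sub>R x + u *\<^sub>R y) \<le> (1 - u) * - g x + u * - g y"
    proof (cases "x = y")
      case True
      then show ?thesis by (simp add: algebra_simps)
    next
      case False
      then have "(1 - u) * g x + u * g y < g ((1 - u) * x + u * y)"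
        using g u xy unfolding strictly_concave_on_def by blast
      then show ?thesis by simp
    qed
  qed simp
  have nonstrict: "g y \<le> g a + D * (y - a)" if "0 \<le> y" for y
  proof -
    have "((\<lambda>x. - g x) has_real_derivative - D) (at a within {0..})"
      using d by (auto intro!: derivative_intros intro: has_field_derivative_at_within)
    then have "- g y - - g a \<ge> - D * (y - a)"
      using convex_on_imp_above_tangent[OF conv, of a y "- D"] a that by simp
    then show ?thesis by simp
  qed
  have conc: "(1 - u) * g x + u * g y < g ((1 - u) * x + u * y)"
    if "0 \<le> x" "0 \<le> y" "x \<noteq> y" "0 < u" "u < 1" for x y u
    using g that unfolding strictly_concave_on_def by simp
  have "(1 - 1/2) * g a + (1/2) * g b < g ((1 - 1/2) * a + (1/2) * b)"
    by (rule conc) (use a b \<open>b \<noteq> a\<close> in auto)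
  moreover have "g ((1 - 1/2) * a + (1/2) * b) \<le> g a + D * ((1 - 1/2) * a + (1/2) * b - a)"
    by (rule nonstrict) (use a b in auto)
  ultimately show ?thesis by (simp add: algebra_simps)
qed

subsection \<open>Line flows and their cost\<close>

lemma sum_strategies_swap:
  fixes g :: "'n::finite \<Rightarrow> 'n set \<Rightarrow> real"
  shows "(\<Sum>i\<in>UNIV. \<Sum>s\<in>{s\<in>strategies. i \<in> s}. g i s) = (\<Sum>s\<in>strategies. \<Sum>i\<in>s. g i s)"
  using sum.swap_restrict[of "UNIV :: 'n set" "strategies :: 'n set set" g "\<lambda>i s. i \<in> s"] by simp

definition expected_wait ::
    "('n::finite \<Rightarrow> real \<Rightarrow> real) \<Rightarrow> ('n set \<Rightarrow> real) \<Rightarrow> ('n \<Rightarrow> real) \<Rightarrow> real" where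
  "expected_wait f h v = (\<Sum>s\<in>strategies. h s / (\<Sum>j\<in>s. f j (v j)))"

text \<open>Starting from the lines with positive \<open>a\<close>, lower all of them by the smallest positive value
  and repeat: the strategies used are nested.\<close>

lemma nested_strategies:
  fixes a :: "'n::finite \<Rightarrow> real"
  assumes "\<And>i. 0 \<le> a i" "\<And>i. a i \<le> m" "0 \<le> m"
  shows "\<exists>g. (\<forall>s. 0 \<le> g s) \<and> (\<forall>i. (\<Sum>s\<in>{s\<in>strategies. i \<in> s}. g s) = a i) \<and>
    (\<Sum>s\<in>strategies. g s) \<le> m"
  using assms
proof (induction "card {i. 0 < a i}" arbitrary: a m rule: less_induct)
  case less
  define S where "S = {i. 0 < a i}"
  show ?case
  proof (cases "S = {}")
    case True
    then have "a i = 0" for i using less.prems(1)[of i] by (metis S_def empty_Collect_eq less_eq_real_def)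
    then show ?thesis using less.prems by (intro exI[of _ "\<lambda>_. 0"]) simp
  next
    case False
    define c where "c = Min (a ` S)"
    have "c \<in> a ` S" unfolding c_def using False by (intro Min_in) auto
    then obtain k where k: "k \<in> S" "a k = c" by blast
    have c: "0 < c" using k by (simp add: S_def)
    have c_le: "c \<le> a i" if "i \<in> S" for i unfolding c_def using that by (intro Min_le) auto
    define a' where "a' i = (if i \<in> S then a i - c else 0)" for i
    have nn: "0 \<le> a' i" for i using c_le by (simp add: a'_def)
    have "{i. 0 < a' i} \<subset> S" using k by (auto simp: a'_def)
    then have card: "card {i. 0 < a' i} < card {i. 0 < a i}"
      unfolding S_def by (intro psubset_card_mono) auto
    have cm: "c \<le> m" using less.prems(2)[of k] k by simp
    have "a' i \<le> m - c" for i using less.prems(2)[of i] cm by (simp add: a'_def)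
    then obtain g where g: "\<And>s. 0 \<le> g s" "\<And>i. (\<Sum>s\<in>{s\<in>strategies. i \<in> s}. g s) = a' i"
        "(\<Sum>s\<in>strategies. g s) \<le> m - c"
      using less.hyps[OF card nn, of "m - c"] cm by auto
    define g' where "g' s = g s + (if s = S then c else 0)" for s
    have str: "S \<in> strategies" using False by (simp add: strategies_def)
    have "(\<Sum>s\<in>{s\<in>strategies. i \<in> s}. g' s) = a i" for i
    proof -
      have "(\<Sum>s\<in>{s\<in>strategies. i \<in> s}. g' s) = a' i + (if i \<in> S then c else 0)"
        using str by (simp add: g'_def sum.distrib g(2))
      then show ?thesis using less.prems(1)[of i] by (auto simp: a'_def S_def)
    qed
    moreover have "(\<Sum>s\<in>strategies. g' s) \<le> m"
      using g(3) str by (simp add: g'_def sum.distrib)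
    moreover have "0 \<le> g' s" for s using g(1)[of s] c by (simp add: g'_def)
    ultimately show ?thesis by blast
  qed
qed

context
  fixes t :: "'n::finite \<Rightarrow> real" and vb :: "'n \<Rightarrow> ereal" and f :: "'n \<Rightarrow> real \<Rightarrow> real"
  assumes f: "\<And>i. effective_frequency (vb i) (f i)"
begin

lemma induces_line_flow_range: "induces_line_flow vb f h v \<Longrightarrow> v i \<in> flow_range (vb i)"
  by (simp add: induces_line_flow_def)

lemma frequency_sum_pos:
  assumes "\<And>i. v i \<in> flow_range (vb i)" "s \<in> strategies"
  shows "0 < (\<Sum>j\<in>s. f j (v j))"
  using assms effective_frequency_pos[OF f]
  by (intro sum_pos) (auto simp: strategies_def)

lemma induces_line_flow_eq:
  "induces_line_flow vb f h v \<Longrightarrow>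
    v i = (\<Sum>s\<in>{s\<in>strategies. i \<in> s}. h s * (f i (v i) / (\<Sum>j\<in>s. f j (v j))))"
  unfolding induces_line_flow_def by blast

text \<open>Within each strategy the shares of its lines add up to 1.\<close>

lemma induces_line_flow_sum:
  assumes "induces_line_flow vb f h v"
  shows "(\<Sum>i\<in>UNIV. v i) = (\<Sum>s\<in>strategies. h s)"
proof -
  have "(\<Sum>i\<in>UNIV. v i) = (\<Sum>s\<in>strategies. \<Sum>i\<in>s. h s * (f i (v i) / (\<Sum>j\<in>s. f j (v j))))"
    unfolding sum_strategies_swap[symmetric] using induces_line_flow_eq[OF assms] by (rule sum.cong[OF refl])
  also have "\<dots> = (\<Sum>s\<in>strategies. h s)"
  proof (rule sum.cong[OF refl])
    fix s :: "'n set" assume "s \<in> strategies"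
    then have "0 < (\<Sum>j\<in>s. f j (v j))"
      using frequency_sum_pos[of v] induces_line_flow_range[OF assms] by blast
    then show "(\<Sum>i\<in>s. h s * (f i (v i) / (\<Sum>j\<in>s. f j (v j)))) = h s"
      by (simp flip: sum_distrib_left sum_divide_distrib)
  qed
  finally show ?thesis .
qed

lemma cost_decomposition:
  assumes "induces_line_flow vb f h v"
  shows "(\<Sum>s\<in>strategies. h s * transit_time t f s v) = (\<Sum>i\<in>UNIV. t i * v i) + expected_wait f h v"
proof -
  have "(\<Sum>i\<in>UNIV. t i * v i) =
      (\<Sum>i\<in>UNIV. \<Sum>s\<in>{s\<in>strategies. i \<in> s}. t i * (h s * (f i (v i) / (\<Sum>j\<in>s. f j (v j)))))"
    unfolding sum_distrib_left[symmetric] using induces_line_flow_eq[OF assms]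
    by (intro sum.cong[OF refl]) metis
  also have "\<dots> = (\<Sum>s\<in>strategies. \<Sum>i\<in>s. t i * (h s * (f i (v i) / (\<Sum>j\<in>s. f j (v j)))))"
    by (rule sum_strategies_swap)
  also have "\<dots> = (\<Sum>s\<in>strategies. h s * ((\<Sum>i\<in>s. t i * f i (v i)) / (\<Sum>j\<in>s. f j (v j))))"
    by (intro sum.cong[OF refl]) (simp add: sum_distrib_left sum_divide_distrib mult.left_commute)
  finally show ?thesis
    unfolding transit_time_def expected_wait_def
    by (simp add: add_divide_distrib distrib_left sum.distrib)
qed

text \<open>Dividing the flow equation of line \<open>i\<close> by its frequency leaves exactly the
  part of the expected wait due to strategies containing \<open>i\<close>.\<close>

lemma ratio_le_expected_wait:
  assumes h: "\<And>s. s \<in> strategies \<Longrightarrow> 0 \<le> h s" and v: "induces_line_flow vb f h v"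
  shows "v i / f i (v i) \<le> expected_wait f h v"
proof -
  have pos: "0 < f i (v i)" using effective_frequency_pos[OF f] induces_line_flow_range[OF v] .
  have "v i = f i (v i) * (\<Sum>s\<in>{s\<in>strategies. i \<in> s}. h s / (\<Sum>j\<in>s. f j (v j)))"
    by (subst induces_line_flow_eq[OF v]) (simp add: sum_distrib_left mult.commute)
  then have "v i / f i (v i) = (\<Sum>s\<in>{s\<in>strategies. i \<in> s}. h s / (\<Sum>j\<in>s. f j (v j)))"
    using pos by (metis less_irrefl nonzero_mult_div_cancel_left)
  also have "\<dots> \<le> expected_wait f h v"
    unfolding expected_wait_def
  proof (rule sum_mono2)
    fix s :: "'n set" assume "s \<in> strategies - {s \<in> strategies. i \<in> s}"
    then show "0 \<le> h s / (\<Sum>j\<in>s. f j (v j))"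
      using h frequency_sum_pos[of v s] induces_line_flow_range[OF v] by (simp add: less_imp_le)
  qed auto
  finally show ?thesis .
qed

lemma expected_wait_nonneg:
  assumes "\<And>s. s \<in> strategies \<Longrightarrow> 0 \<le> h s" "induces_line_flow vb f h v"
  shows "0 \<le> expected_wait f h v"
  unfolding expected_wait_def
  using assms frequency_sum_pos[of v] induces_line_flow_range[OF assms(2)]
  by (intro sum_nonneg) (simp add: less_imp_le)

text \<open>If \<open>r = max f\<^sub>j (u\<^sub>j) / f\<^sub>j (v\<^sub>j)\<close> exceeded 1, then the share of a maximising line in
  every strategy would be at least as large under \<open>u\<close> as under \<open>v\<close>, although \<open>u\<^sub>j < v\<^sub>j\<close>.\<close>

lemma induced_frequency_le:
  assumes h: "\<And>s. s \<in> strategies \<Longrightarrow> 0 \<le> h s"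
    and v: "induces_line_flow vb f h v" and u: "induces_line_flow vb f h u"
  shows "f i (u i) \<le> f i (v i)"
proof (rule ccontr)
  assume contra: "\<not> f i (u i) \<le> f i (v i)"
  note vr = induces_line_flow_range[OF v] and ur = induces_line_flow_range[OF u]
  note vp = effective_frequency_pos[OF f vr] and up = effective_frequency_pos[OF f ur]
  define q where "q j = f j (u j) / f j (v j)" for j
  define r where "r = Max (range q)"
  have "r \<in> range q" unfolding r_def by (intro Max_in) auto
  then obtain j where j: "q j = r" by blast
  have q_le: "q k \<le> r" for k unfolding r_def by (intro Max_ge) auto
  have "1 < q i" using contra vp[of i] by (simp add: q_def)
  then have r: "1 < r" using q_le[of i] by linarith
  have fu: "f k (u k) = q k * f k (v k)" for k using vp[of k] by (simp add: q_def)
  have "f j (v j) < f j (u j)" using r vp[of j] by (simp add: fu j)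
  then have "u j < v j"
    using effective_frequency_strict_antimono[OF f vr[of j] ur[of j]]
    by (metis less_asym less_irrefl linorder_neqE_linordered_idom)
  moreover have "v j \<le> u j"
  proof -
    have "f j (v j) / (\<Sum>k\<in>s. f k (v k)) \<le> f j (u j) / (\<Sum>k\<in>s. f k (u k))" if s: "s \<in> strategies" for s
    proof -
      have pos: "0 < (\<Sum>k\<in>s. f k (v k))" "0 < (\<Sum>k\<in>s. f k (u k))"
        using frequency_sum_pos[OF vr s] frequency_sum_pos[OF ur s] .
      have "(\<Sum>k\<in>s. f k (u k)) \<le> (\<Sum>k\<in>s. r * f k (v k))"
        using q_le vp by (intro sum_mono) (simp add: fu less_imp_le mult_right_mono)
      also have "\<dots> = r * (\<Sum>k\<in>s. f k (v k))" by (simp add: sum_distrib_left)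
      finally have "f j (v j) * (\<Sum>k\<in>s. f k (u k)) \<le> f j (v j) * (r * (\<Sum>k\<in>s. f k (v k)))"
        using vp[of j] by simp
      also have "\<dots> = f j (u j) * (\<Sum>k\<in>s. f k (v k))" by (simp add: fu j)
      finally show ?thesis using pos by (simp add: divide_le_eq pos_le_divide_eq)
    qed
    then have "(\<Sum>s\<in>{s\<in>strategies. j \<in> s}. h s * (f j (v j) / (\<Sum>k\<in>s. f k (v k)))) \<le>
        (\<Sum>s\<in>{s\<in>strategies. j \<in> s}. h s * (f j (u j) / (\<Sum>k\<in>s. f k (u k))))"
      using h by (intro sum_mono mult_left_mono) auto
    then show ?thesis using induces_line_flow_eq[OF v, of j] induces_line_flow_eq[OF u, of j] by simp
  qed
  ultimately show False by simp
qed

text \<open>Comparing two induced flows in both directions makes all frequencies equal, and each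
  \<open>f i\<close> is injective.\<close>

lemma line_flow_eq:
  assumes h: "\<And>s. s \<in> strategies \<Longrightarrow> 0 \<le> h s" and v: "induces_line_flow vb f h v"
  shows "line_flow vb f h = v"
  unfolding line_flow_def
proof (rule the_equality)
  fix u assume u: "induces_line_flow vb f h u"
  have "f i (u i) = f i (v i)" for i
    using induced_frequency_le[OF h v u] induced_frequency_le[OF h u v] by (meson order_antisym)
  then show "u = v"
    using effective_frequency_strict_antimono[OF f induces_line_flow_range[OF u] induces_line_flow_range[OF v]]
      effective_frequency_strict_antimono[OF f induces_line_flow_range[OF v] induces_line_flow_range[OF u]]
    by (intro ext) (metis less_irrefl linorder_neqE_linordered_idom)
qed (rule v)

text \<open>One half of the reduction: a feasible \<open>h\<close> yields an admissible point of the
  reduced problem with the same cost, its expected wait taking the place of \<alpha>.\<close>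

lemma feasible_cost:
  assumes "feasible vb f x h"
  obtains v where "induces_line_flow vb f h v" "line_flow vb f h = v" "(\<Sum>i\<in>UNIV. v i) = x"
    "total_cost t vb f h = (\<Sum>i\<in>UNIV. t i * v i) + expected_wait f h v"
    "0 \<le> expected_wait f h v" "\<And>i. v i / f i (v i) \<le> expected_wait f h v"
proof -
  from assms obtain v where h: "\<And>s. s \<in> strategies \<Longrightarrow> 0 \<le> h s" "(\<Sum>s\<in>strategies. h s) = x"
    and v: "induces_line_flow vb f h v"
    unfolding feasible_def by blast
  show thesis
    using that[OF v] line_flow_eq[of h v] h v induces_line_flow_sum[OF v] cost_decomposition[OF v]
      expected_wait_nonneg[of h v] ratio_le_expected_wait[of h v]
    by (simp add: total_cost_def)
qed

text \<open>The other half of the reduction; an inequality between the costs suffices, since the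
  reduced problem already bounds them from below.\<close>

lemma realise_line_flow:
  assumes v: "\<And>i. v i \<in> flow_range (vb i)" and x: "(\<Sum>i\<in>UNIV. v i) = x"
    and m: "\<And>i. v i / f i (v i) \<le> m"
  obtains h where "feasible vb f x h" "line_flow vb f h = v"
    "total_cost t vb f h \<le> (\<Sum>i\<in>UNIV. t i * v i) + m"
proof -
  note vp = effective_frequency_pos[OF f v]
  have nn: "0 \<le> v i / f i (v i)" for i using vp[of i] flow_rangeD[OF v[of i]] by simp
  then have "0 \<le> m" using m by (meson order_trans)
  with nn m obtain g where g: "\<And>s. 0 \<le> g s"
      "\<And>i. (\<Sum>s\<in>{s\<in>strategies. i \<in> s}. g s) = v i / f i (v i)" "(\<Sum>s\<in>strategies. g s) \<le> m"
    using nested_strategies[of "\<lambda>i. v i / f i (v i)" m] by auto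
  \<comment> \<open>The factor cancels the denominators of the shares, so the flow equation of line
    \<open>i\<close> becomes \<open>f i (v i)\<close> times the sum of \<open>g s\<close> over the
    strategies containing \<open>i\<close>.\<close>
  define h where "h s = g s * (\<Sum>j\<in>s. f j (v j))" for s
  note pos = frequency_sum_pos[OF v]
  have h: "0 \<le> h s" if "s \<in> strategies" for s using g(1)[of s] pos[OF that] by (simp add: h_def)
  have ind: "induces_line_flow vb f h v"
    unfolding induces_line_flow_def
  proof (intro allI conjI)
    fix i
    have "(\<Sum>s\<in>{s\<in>strategies. i \<in> s}. h s * (f i (v i) / (\<Sum>j\<in>s. f j (v j)))) =
        (\<Sum>s\<in>{s\<in>strategies. i \<in> s}. g s * f i (v i))"
      using pos by (intro sum.cong[OF refl]) (force simp: h_def)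
    also have "\<dots> = v i" using vp[of i] by (simp add: g(2) flip: sum_distrib_right)
    finally show "v i = (\<Sum>s\<in>{s\<in>strategies. i \<in> s}. h s * (f i (v i) / (\<Sum>j\<in>s. f j (v j))))" ..
  qed (rule v)
  have "expected_wait f h v = (\<Sum>s\<in>strategies. g s)"
    unfolding expected_wait_def using pos by (intro sum.cong[OF refl]) (force simp: h_def)
  then have "total_cost t vb f h \<le> (\<Sum>i\<in>UNIV. t i * v i) + m"
    using cost_decomposition[OF ind] line_flow_eq[OF h ind] g(3) by (simp add: total_cost_def)
  moreover have "feasible vb f x h"
    unfolding feasible_def using h ind induces_line_flow_sum[OF ind] x by auto
  ultimately show thesis using that line_flow_eq[OF h ind] by blast
qed

end

subsection \<open>Lagrangian duality\<close>

text \<open>These are the complementary slackness conditions for the multiplier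
  \<open>lambda_bar t w \<alpha>\<close>.\<close>

definition threshold_flow ::
    "('n::finite \<Rightarrow> real) \<Rightarrow> ('n \<Rightarrow> real \<Rightarrow> real) \<Rightarrow> real \<Rightarrow> ('n \<Rightarrow> real) \<Rightarrow> bool" where
  "threshold_flow t w \<alpha> v \<longleftrightarrow>
    (\<forall>i. (t i > lambda_bar t w \<alpha> \<longrightarrow> v i = 0) \<and>
         (t i < lambda_bar t w \<alpha> \<longrightarrow> v i = w i \<alpha>) \<and>
         (t i = lambda_bar t w \<alpha> \<longrightarrow> 0 \<le> v i \<and> v i \<le> w i \<alpha>))"

lemma sum_lt_saturation:
  fixes vb :: "'n::finite \<Rightarrow> ereal"
  assumes vb: "\<And>i. 0 < vb i" and x: "0 < x" "ereal x < (\<Sum>i\<in>UNIV. vb i)"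
  obtains u where "\<And>i. u i \<in> flow_range (vb i)" "x < (\<Sum>i\<in>UNIV. u i)"
proof (cases "\<exists>j. vb j = \<infinity>")
  case True
  then obtain j where j: "vb j = \<infinity>" ..
  show thesis
  proof (rule that)
    show "(if i = j then x + 1 else 0) \<in> flow_range (vb i)" for i
      using j x(1) zero_in_flow_range[OF vb[of i]] by (simp add: flow_range_def)
    show "x < (\<Sum>i\<in>UNIV. if i = j then x + 1 else 0)" by simp
  qed
next
  case False
  define b where "b i = real_of_ereal (vb i)" for i
  have b: "vb i = ereal (b i)" for i
    using False vb[of i] by (cases "vb i") (auto simp: b_def)
  have bp: "0 < b i" for i using vb[of i] b[of i] by simp
  define B where "B = (\<Sum>i\<in>UNIV. b i)"
  have xB: "x < B" using x(2) by (simp add: b B_def)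
  \<comment> \<open>Scaling all saturation flows by this factor puts their sum at the midpoint of
    \<open>x\<close> and \<open>B\<close>.\<close>
  define \<theta> where "\<theta> = (x + B) / (2 * B)"
  have \<theta>: "0 < \<theta>" "\<theta> < 1" using x(1) xB by (auto simp: \<theta>_def)
  show thesis
  proof (rule that)
    show "\<theta> * b i \<in> flow_range (vb i)" for i
      using \<theta> bp[of i] by (simp add: flow_range_def b)
    have "\<theta> * B = (x + B) / 2" using x(1) xB by (simp add: \<theta>_def)
    then show "x < (\<Sum>i\<in>UNIV. \<theta> * b i)"
      using xB by (simp add: B_def flip: sum_distrib_left)
  qed
qed

text \<open>Concavity enters as a strict tangent inequality that includes \<open>b = 0\<close>,
  since an expected wait is only known to be nonnegative. Existence of \<alpha> will take continuity
  and limits in addition.\<close>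

locale concave_flows =
  fixes t :: "'n::finite \<Rightarrow> real" and w :: "'n \<Rightarrow> real \<Rightarrow> real"
  assumes w_nonneg: "\<And>i a. 0 \<le> a \<Longrightarrow> 0 \<le> w i a"
    and w_deriv_pos: "\<And>i a. 0 < a \<Longrightarrow> 0 < deriv (w i) a"
    and w_tangent: "\<And>i a b. 0 < a \<Longrightarrow> 0 \<le> b \<Longrightarrow> b \<noteq> a \<Longrightarrow> w i b < w i a + deriv (w i) a * (b - a)"
begin

text \<open>Below all \<open>t i\<close> the function is constantly 0. Positivity at
  \<open>l'\<close> provides a line with \<open>t i < l'\<close>, whose term rises strictly.\<close>

lemma psi_strict_mono:
  assumes a: "0 < a" and "l < l'" and l': "0 < psi t w a l'"
  shows "psi t w a l < psi t w a l'"
proof -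
  have "\<exists>i. t i < l'"
  proof (rule ccontr)
    assume "\<nexists>i. t i < l'"
    then have "psi t w a l' = 0" unfolding psi_def by (intro sum.neutral) (auto simp: max_def not_less)
    then show False using l' by simp
  qed
  then obtain i where i: "t i < l'" ..
  show ?thesis
    unfolding psi_def
  proof (rule sum_strict_mono_ex1)
    show "\<forall>i\<in>UNIV. max (l - t i) 0 * deriv (w i) a \<le> max (l' - t i) 0 * deriv (w i) a"
      using w_deriv_pos[OF a] \<open>l < l'\<close> by (auto intro!: mult_right_mono less_imp_le[of 0])
    show "\<exists>i\<in>UNIV. max (l - t i) 0 * deriv (w i) a < max (l' - t i) 0 * deriv (w i) a"
      using w_deriv_pos[OF a, of i] i \<open>l < l'\<close> by (intro bexI[of _ i]) auto
  qed simp
qed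

lemma psi_eq_1_ex1:
  assumes a: "0 < a"
  shows "\<exists>!l. psi t w a l = 1"
proof -
  obtain k :: 'n where True by simp
  define l0 where "l0 = Min (range t)"
  have l0: "l0 \<le> t i" for i unfolding l0_def by (intro Min_le) auto
  then have psi0: "psi t w a l0 = 0"
    unfolding psi_def by (intro sum.neutral) (simp add: max_def)
  \<comment> \<open>At this point the term of the single line \<open>k\<close> already equals
    1.\<close>
  define l1 where "l1 = t k + 1 / deriv (w k) a"
  have "1 = max (l1 - t k) 0 * deriv (w k) a"
    using w_deriv_pos[OF a, of k] by (simp add: l1_def)
  also have "\<dots> \<le> psi t w a l1"
    unfolding psi_def by (rule member_le_sum) (auto intro!: mult_nonneg_nonneg less_imp_le[OF w_deriv_pos[OF a]])
  finally have psi1: "1 \<le> psi t w a l1" .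
  have "l0 \<le> l1" using l0[of k] w_deriv_pos[OF a, of k] by (simp add: l1_def add_increasing2)
  moreover have "continuous_on {l0..l1} (psi t w a)"
    unfolding psi_def by (intro continuous_intros)
  ultimately obtain l where "psi t w a l = 1"
    using IVT'[of "psi t w a" l0 1 l1] psi0 psi1 by auto
  then show ?thesis
    by (rule ex1I) (metis \<open>psi t w a l = 1\<close> a psi_strict_mono less_irrefl linorder_neqE_linordered_idom zero_less_one)
qed

lemma psi_lambda_bar: "0 < a \<Longrightarrow> psi t w a (lambda_bar t w a) = 1"
  unfolding lambda_bar_def by (rule theI'[OF psi_eq_1_ex1])

lemma less_lambda_bar_iff:
  assumes "0 < a"
  shows "l < lambda_bar t w a \<longleftrightarrow> psi t w a l < 1"
    and "l \<le> lambda_bar t w a \<longleftrightarrow> psi t w a l \<le> 1"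
proof -
  define m where "m = lambda_bar t w a"
  have m: "psi t w a m = 1" unfolding m_def using psi_lambda_bar[OF assms] .
  have lt: "psi t w a l < 1" if "l < m" using psi_strict_mono[OF assms that] m by simp
  have gt: "1 < psi t w a l" if "m < l"
  proof (rule ccontr)
    assume "\<not> 1 < psi t w a l"
    \<comment> \<open>Strict monotonicity presupposes a positive value at the larger argument; weak
      monotonicity from \<open>m\<close> supplies it.\<close>
    moreover have "0 < psi t w a l"
    proof -
      have "psi t w a m \<le> psi t w a l"
        unfolding psi_def using that
        by (intro sum_mono mult_right_mono less_imp_le[OF w_deriv_pos[OF assms]]) auto
      then show ?thesis using m by simp
    qed
    ultimately show False using psi_strict_mono[OF assms that] m by simp
  qed
  show "l < lambda_bar t w a \<longleftrightarrow> psi t w a l < 1" "l \<le> lambda_bar t w a \<longleftrightarrow> psi t w a l \<le> 1"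
    using lt gt m unfolding m_def[symmetric] by (cases l m rule: linorder_cases; simp)+
qed

text \<open>Every admissible pair \<open>(u, b)\<close> costs at least the dual value
  \<open>l * x + b - (\<Sum>i\<in>UNIV. c i * w i b)\<close>, and \<open>(v, a)\<close> attains it.
  This value has its strict minimum at \<open>b = a\<close>, so a pair that costs no more than
  \<open>(v, a)\<close> has \<open>b = a\<close> and no slack on any line.\<close>

lemma threshold_flow_optimal:
  assumes a: "0 < a" and v: "threshold_flow t w a v" and vx: "(\<Sum>i\<in>UNIV. v i) = x"
    and b: "0 \<le> b" and u: "\<And>i. 0 \<le> u i" "\<And>i. u i \<le> w i b" and ux: "(\<Sum>i\<in>UNIV. u i) = x"
  shows "(\<Sum>i\<in>UNIV. t i * v i) + a \<le> (\<Sum>i\<in>UNIV. t i * u i) + b"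
    and "(\<Sum>i\<in>UNIV. t i * u i) + b \<le> (\<Sum>i\<in>UNIV. t i * v i) + a \<Longrightarrow> b = a \<and> threshold_flow t w a u"
proof -
  define l where "l = lambda_bar t w a"
  define c where "c i = max (l - t i) 0" for i
  have c: "0 \<le> c i" for i by (simp add: c_def)
  have c1: "(\<Sum>i\<in>UNIV. c i * deriv (w i) a) = 1"
    using psi_lambda_bar[OF a] by (simp add: psi_def c_def l_def)
  have dual: "(\<Sum>i\<in>UNIV. t i * z i) = l * x + (\<Sum>i\<in>UNIV. (t i - l) * z i)"
    if "(\<Sum>i\<in>UNIV. z i) = x" for z
    by (simp add: left_diff_distrib sum_subtractf that flip: sum_distrib_left)
  have "(t i - l) * v i = - (c i * w i a)" for i
    using v unfolding threshold_flow_def l_def[symmetric] c_def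
    by (cases "t i" l rule: linorder_cases) (auto simp: algebra_simps)
  then have v_val: "(\<Sum>i\<in>UNIV. t i * v i) = l * x - (\<Sum>i\<in>UNIV. c i * w i a)"
    by (simp add: dual[OF vx] sum_negf)
  have term_ge: "- (c i * w i b) \<le> (t i - l) * u i" for i
  proof (cases "t i < l")
    case True
    then have "(l - t i) * u i \<le> (l - t i) * w i b" using u(2)[of i] by (intro mult_left_mono) auto
    then show ?thesis using True by (simp add: c_def algebra_simps)
  next
    case False
    then show ?thesis using u(1)[of i] by (simp add: c_def)
  qed
  have u_val: "l * x - (\<Sum>i\<in>UNIV. c i * w i b) \<le> (\<Sum>i\<in>UNIV. t i * u i)"
    using sum_mono[of UNIV, OF term_ge] by (simp add: dual[OF ux] sum_negf)
  \<comment> \<open>The tangent inequalities are added with weights \<open>c i\<close>; by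
    \<open>c1\<close> the slopes add up to 1, which also forces some weight to be positive.\<close>
  have strict: "(\<Sum>i\<in>UNIV. c i * w i b) < (\<Sum>i\<in>UNIV. c i * w i a) + (b - a)" if "b \<noteq> a"
  proof -
    have "(\<Sum>i\<in>UNIV. c i * w i b) < (\<Sum>i\<in>UNIV. c i * (w i a + deriv (w i) a * (b - a)))"
    proof (rule sum_strict_mono_ex1)
      show "\<forall>i\<in>UNIV. c i * w i b \<le> c i * (w i a + deriv (w i) a * (b - a))"
        by (intro ballI mult_left_mono less_imp_le[OF w_tangent[OF a b that]] c)
      have "\<exists>i. c i \<noteq> 0"
      proof (rule ccontr)
        assume "\<nexists>i. c i \<noteq> 0"
        then show False using c1 by simp
      qed
      then obtain i where "c i \<noteq> 0" ..
      with c[of i] have "0 < c i" by simp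
      then show "\<exists>i\<in>UNIV. c i * w i b < c i * (w i a + deriv (w i) a * (b - a))"
        using w_tangent[OF a b that] by (intro bexI[of _ i]) auto
    qed simp
    also have "\<dots> = (\<Sum>i\<in>UNIV. c i * w i a) + (\<Sum>i\<in>UNIV. c i * deriv (w i) a) * (b - a)"
      by (simp add: distrib_left sum.distrib sum_distrib_right mult.assoc)
    finally show ?thesis by (simp add: c1)
  qed
  show "(\<Sum>i\<in>UNIV. t i * v i) + a \<le> (\<Sum>i\<in>UNIV. t i * u i) + b"
    using u_val v_val strict by (cases "b = a") auto
  assume le: "(\<Sum>i\<in>UNIV. t i * u i) + b \<le> (\<Sum>i\<in>UNIV. t i * v i) + a"
  then have ba: "b = a" using u_val v_val strict by fastforce
  \<comment> \<open>For \<open>b = a\<close> the excess cost is a sum of nonnegative slacks, one per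
    line, so each of them vanishes.\<close>
  have "(\<Sum>i\<in>UNIV. (t i - l) * u i + c i * w i a) \<le> 0"
    using le v_val dual[OF ux] by (simp add: ba sum.distrib)
  moreover have nn: "0 \<le> (t i - l) * u i + c i * w i a" for i using term_ge[of i] by (simp add: ba)
  ultimately have "(\<Sum>i\<in>UNIV. (t i - l) * u i + c i * w i a) = 0"
    by (intro antisym sum_nonneg) auto
  then have z: "(t i - l) * u i + c i * w i a = 0" for i
    using nn by (subst (asm) sum_nonneg_eq_0_iff) auto
  have "threshold_flow t w a u"
    unfolding threshold_flow_def l_def[symmetric]
  proof (intro allI conjI impI)
    fix i
    show "u i = 0" if "t i > l" using z[of i] that by (simp add: c_def)
    show "u i = w i a" if "t i < l"
    proof -
      have "(l - t i) * (w i a - u i) = 0" using z[of i] that by (simp add: c_def algebra_simps)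
      then show ?thesis using that by simp
    qed
    show "0 \<le> u i" "u i \<le> w i a" using u[of i] by (simp_all add: ba)
  qed
  with ba show "b = a \<and> threshold_flow t w a u" ..
qed

section \<open>Threshold flows of given demand and the choice of \<alpha>\<close>

lemma threshold_flow_bounds:
  assumes a: "0 < a" and v: "threshold_flow t w a v"
  shows "0 \<le> v i" "v i \<le> w i a"
  using v w_nonneg[of a i] a unfolding threshold_flow_def
  by (cases "t i" "lambda_bar t w a" rule: linorder_cases; force)+

lemma threshold_flow_exists:
  assumes a: "0 < a" and x: "x \<in> {x_hat t w a..x_check t w a}"
  obtains v where "threshold_flow t w a v" "(\<Sum>i\<in>UNIV. v i) = x"
proof -
  define l where "l = lambda_bar t w a"
  define E where "E = (\<Sum>i | t i = l. w i a)"
  have split: "x_check t w a = x_hat t w a + E"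
  proof -
    have "{i. t i \<le> l} = {i. t i < l} \<union> {i. t i = l}" by auto
    then show ?thesis
      unfolding x_check_def x_hat_def E_def l_def[symmetric]
      by (simp add: sum.union_disjoint[of "{i. t i < l}" "{i. t i = l}"] disjoint_iff)
  qed
  \<comment> \<open>All lines with \<open>t i = l\<close> carry the same fraction of their capacity.
    If \<open>E = 0\<close>, division gives \<theta> = 0, which fits because then
    \<open>x = x_hat t w a\<close>.\<close>
  define \<theta> where "\<theta> = (x - x_hat t w a) / E"
  have E: "0 \<le> E" unfolding E_def using w_nonneg a by (intro sum_nonneg) auto
  have \<theta>E: "\<theta> * E = x - x_hat t w a" using x split by (cases "E = 0") (auto simp: \<theta>_def)
  have \<theta>: "0 \<le> \<theta>" "\<theta> \<le> 1"
    using x split E by (auto simp: \<theta>_def divide_le_eq_1)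
  define v where "v i = (if t i < l then w i a else 0) + (if t i = l then \<theta> * w i a else 0)" for i
  show thesis
  proof (rule that)
    show "threshold_flow t w a v"
      unfolding threshold_flow_def l_def[symmetric] v_def
      using \<theta> w_nonneg[of a] a by (auto intro!: mult_left_le_one_le)
    have "(\<Sum>i\<in>UNIV. v i) = x_hat t w a + \<theta> * E"
      unfolding v_def x_hat_def E_def l_def[symmetric]
      by (simp add: sum.distrib sum.If_cases sum_distrib_left)
    then show "(\<Sum>i\<in>UNIV. v i) = x" using \<theta>E by simp
  qed
qed

text \<open>Threshold flows for \<open>a\<close> and for \<open>b\<close> compete in the same
  problem, so each is optimal and the equality case of duality identifies the parameters.\<close>

lemma alpha_unique:
  assumes "0 < a" "x \<in> {x_hat t w a..x_check t w a}" "0 < b" "x \<in> {x_hat t w b..x_check t w b}"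
  shows "a = b"
proof -
  obtain v where v: "threshold_flow t w a v" "(\<Sum>i\<in>UNIV. v i) = x"
    using threshold_flow_exists assms(1,2) by blast
  obtain u where u: "threshold_flow t w b u" "(\<Sum>i\<in>UNIV. u i) = x"
    using threshold_flow_exists assms(3,4) by blast
  have "(\<Sum>i\<in>UNIV. t i * u i) + b \<le> (\<Sum>i\<in>UNIV. t i * v i) + a"
    using threshold_flow_optimal(1)[OF assms(3) u less_imp_le[OF assms(1)]
        threshold_flow_bounds[OF assms(1) v(1)] v(2)] .
  then show ?thesis
    using threshold_flow_optimal(2)[OF assms(1) v less_imp_le[OF assms(3)]
        threshold_flow_bounds[OF assms(3) u(1)] u(2)] by simp
qed

text \<open>\<open>\<alpha>\<close> is the supremum of \<open>{a > 0. x_hat t w a \<le> x}\<close>.  Since \<open>t i < lambda_bar t w a\<close> means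
  \<open>psi t w a (t i) < 1\<close>, an open condition on \<open>a\<close>, no continuity of \<open>lambda_bar\<close> is needed.\<close>

lemma alpha_exists:
  assumes w_cont: "\<And>i a. 0 < a \<Longrightarrow> isCont (w i) a"
    and w'_cont: "\<And>i a. 0 < a \<Longrightarrow> isCont (deriv (w i)) a"
    and w_0: "\<And>i. (w i \<longlongrightarrow> 0) (at_right 0)"
    and w_sublinear: "\<And>i e. 0 < e \<Longrightarrow> \<forall>\<^sub>F a in at_top. w i a < e * a"
    and w_large: "\<forall>\<^sub>F a in at_top. x < (\<Sum>i\<in>UNIV. w i a)"
    and x: "0 < x"
  shows "\<exists>a>0. x \<in> {x_hat t w a..x_check t w a}"
proof -
  have hat: "x_hat t w a = (\<Sum>i | psi t w a (t i) < 1. w i a)"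
    and check: "x_check t w a = (\<Sum>i | psi t w a (t i) \<le> 1. w i a)" if "0 < a" for a
    by (simp_all add: x_hat_def x_check_def less_lambda_bar_iff[OF that])
  define B where "B = {a. 0 < a \<and> x_hat t w a \<le> x}"
  \<comment> \<open>\<open>B\<close> is nonempty: for small \<open>a\<close> even the sum of all
    capacities stays below \<open>x\<close>.\<close>
  have "((\<lambda>a. \<Sum>i\<in>UNIV. w i a) \<longlongrightarrow> (\<Sum>i\<in>(UNIV::'n set). 0)) (at_right 0)"
    by (intro tendsto_sum w_0)
  then have "\<forall>\<^sub>F a in at_right 0. (\<Sum>i\<in>UNIV. w i a) < x"
    using x by (intro order_tendstoD(2)) auto
  then have "\<forall>\<^sub>F a in at_right 0. a \<in> B"
    using eventually_at_right_less[of "0::real"]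
  proof eventually_elim
    case (elim a)
    then have "x_hat t w a \<le> (\<Sum>i\<in>UNIV. w i a)"
      unfolding x_hat_def using w_nonneg[of a] by (intro sum_mono2) auto
    then show ?case using elim by (simp add: B_def)
  qed
  then have "\<exists>a. a \<in> B" by (rule eventually_happens'[rotated]) simp
  then obtain a0 where a0: "a0 \<in> B" ..

  \<comment> \<open>The tangent at \<open>a\<close>, evaluated at 0, bounds the slope by
    \<open>w i a / a\<close>, which is eventually below any \<open>e > 0\<close>.\<close>
  have w'_0: "(deriv (w i) \<longlongrightarrow> 0) at_top" for i
  proof (rule order_tendstoI)
    fix e :: real assume e: "e < 0"
    show "\<forall>\<^sub>F a in at_top. e < deriv (w i) a"
      using eventually_gt_at_top[of 0] by eventually_elim (use e in \<open>meson less_trans w_deriv_pos\<close>)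
  next
    fix e :: real assume "0 < e"
    from w_sublinear[OF this, of i] eventually_gt_at_top[of 0]
    show "\<forall>\<^sub>F a in at_top. deriv (w i) a < e"
    proof eventually_elim
      case (elim a)
      then have "deriv (w i) a * a < w i a" using w_tangent[of a 0 i] w_nonneg[of 0 i] by simp
      then have "deriv (w i) a * a < e * a" using elim by linarith
      then show ?case using elim by simp
    qed
  qed
  \<comment> \<open>\<open>B\<close> is bounded: for large \<open>a\<close> every line lies below
    the multiplier, so \<open>x_hat\<close> sums all capacities and exceeds
    \<open>x\<close>.\<close>
  have "\<forall>\<^sub>F a in at_top. psi t w a (t j) < 1" for j
  proof -
    have "((\<lambda>a. psi t w a (t j)) \<longlongrightarrow> (\<Sum>i\<in>UNIV. max (t j - t i) 0 * 0)) at_top"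
      unfolding psi_def by (intro tendsto_intros w'_0)
    then show ?thesis by (rule order_tendstoD(2)) simp
  qed
  then have "\<forall>\<^sub>F a in at_top. \<forall>j. psi t w a (t j) < 1" by (rule eventually_all_finite)
  with w_large eventually_gt_at_top[of 0] have "\<forall>\<^sub>F a in at_top. a \<notin> B"
    by eventually_elim (simp add: B_def hat)
  then obtain N where N: "\<And>a. N \<le> a \<Longrightarrow> a \<notin> B" by (auto simp: eventually_at_top_linorder)
  then have bdd: "bdd_above B" by (meson bdd_aboveI linear)
  define s where "s = Sup B"
  have upper: "a \<le> s" if "a \<in> B" for a unfolding s_def using that bdd by (rule cSup_upper)
  have s: "0 < s" using upper[OF a0] a0 by (simp add: B_def)
  have near: "\<forall>\<^sub>F a in nhds s. 0 < a" using order_tendstoD(1)[OF filterlim_ident s] .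
  have psi_cont: "((\<lambda>a. psi t w a y) \<longlongrightarrow> psi t w s y) (nhds s)" for y
  proof -
    have "((\<lambda>a. deriv (w i) a) \<longlongrightarrow> deriv (w i) s) (nhds s)" for i
      using w'_cont[OF s, of i] by (simp add: isCont_def tendsto_at_iff_tendsto_nhds)
    then show ?thesis unfolding psi_def by (intro tendsto_intros)
  qed
  have w_sum_cont: "((\<lambda>a. \<Sum>i\<in>I. w i a) \<longlongrightarrow> (\<Sum>i\<in>I. w i s)) (nhds s)" for I
    using w_cont[OF s] by (intro tendsto_sum) (simp add: isCont_def tendsto_at_iff_tendsto_nhds)

  have "x_hat t w s \<le> x"
  proof (rule ccontr)
    assume "\<not> x_hat t w s \<le> x"
    \<comment> \<open>The inequalities defining \<open>I\<close> are strict, so near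
      \<open>s\<close> all of \<open>I\<close> is still counted by \<open>x_hat\<close>; its total
      stays above \<open>x\<close>, and \<open>B\<close> has no point near its supremum.\<close>
    define I where "I = {i. psi t w s (t i) < 1}"
    have "x < (\<Sum>i\<in>I. w i s)" using \<open>\<not> x_hat t w s \<le> x\<close> by (simp add: hat[OF s] I_def)
    then have ev1: "\<forall>\<^sub>F a in nhds s. x < (\<Sum>i\<in>I. w i a)"
      by (rule order_tendstoD(1)[OF w_sum_cont])
    have "\<forall>\<^sub>F a in nhds s. i \<in> I \<longrightarrow> psi t w a (t i) < 1" for i
      using order_tendstoD(2)[OF psi_cont, of "t i" 1]
      by (cases "i \<in> I") (auto simp: I_def elim: eventually_mono)
    then have "\<forall>\<^sub>F a in nhds s. \<forall>i. i \<in> I \<longrightarrow> psi t w a (t i) < 1" by (rule eventually_all_finite)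
    with ev1 near have "\<forall>\<^sub>F a in nhds s. a \<notin> B"
    proof eventually_elim
      case (elim a)
      have "(\<Sum>i\<in>I. w i a) \<le> x_hat t w a"
        unfolding hat[OF elim(2)] using elim w_nonneg[of a] by (intro sum_mono2) auto
      then show ?case using elim by (simp add: B_def)
    qed
    then obtain d where d: "0 < d" "\<And>a. dist a s < d \<Longrightarrow> a \<notin> B"
      by (auto simp: eventually_nhds_metric)
    obtain a where "a \<in> B" "s - d < a"
      using less_cSupD[of B "s - d"] a0 d(1) unfolding s_def by auto
    then show False using d(2)[of a] upper[of a] by (simp add: dist_real_def)
  qed
  moreover have "x \<le> x_check t w s"
  proof (rule ccontr)
    assume "\<not> x \<le> x_check t w s"
    \<comment> \<open>Lines outside \<open>J\<close> stay above the multiplier near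
      \<open>s\<close>, so \<open>x_hat\<close> counts at most \<open>J\<close> and stays below
      \<open>x\<close>; then \<open>B\<close> has a point beyond its supremum.\<close>
    define J where "J = {i. psi t w s (t i) \<le> 1}"
    have "(\<Sum>i\<in>J. w i s) < x" using \<open>\<not> x \<le> x_check t w s\<close> by (simp add: check[OF s] J_def)
    then have ev1: "\<forall>\<^sub>F a in nhds s. (\<Sum>i\<in>J. w i a) < x"
      by (rule order_tendstoD(2)[OF w_sum_cont])
    have "\<forall>\<^sub>F a in nhds s. i \<notin> J \<longrightarrow> 1 < psi t w a (t i)" for i
      using order_tendstoD(1)[OF psi_cont, of 1 "t i"]
      by (cases "i \<in> J") (auto simp: J_def elim: eventually_mono)
    then have "\<forall>\<^sub>F a in nhds s. \<forall>i. i \<notin> J \<longrightarrow> 1 < psi t w a (t i)" by (rule eventually_all_finite)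
    with ev1 near have "\<forall>\<^sub>F a in nhds s. a \<in> B"
    proof eventually_elim
      case (elim a)
      have "{i. psi t w a (t i) < 1} \<subseteq> J"
      proof
        fix i assume "i \<in> {i. psi t w a (t i) < 1}"
        then show "i \<in> J" using elim(3) by (metis less_asym mem_Collect_eq)
      qed
      then have "x_hat t w a \<le> (\<Sum>i\<in>J. w i a)"
        unfolding hat[OF elim(2)] using elim w_nonneg[of a] by (intro sum_mono2) auto
      then show ?case using elim by (simp add: B_def)
    qed
    then obtain d where d: "0 < d" "\<And>a. dist a s < d \<Longrightarrow> a \<in> B"
      by (auto simp: eventually_nhds_metric)
    then have "s + d / 2 \<in> B" by (simp add: dist_real_def)
    then show False using upper[of "s + d / 2"] d(1) by simp
  qed
  ultimately show ?thesis using s by auto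
qed

lemma alpha_of_works:
  assumes "0 < a" "x \<in> {x_hat t w a..x_check t w a}"
  shows "0 < alpha_of t w x" "x \<in> {x_hat t w (alpha_of t w x)..x_check t w (alpha_of t w x)}"
proof -
  have "\<exists>!a. 0 < a \<and> x \<in> {x_hat t w a..x_check t w a}"
    using assms alpha_unique by blast
  from theI'[OF this]
  show "0 < alpha_of t w x" "x \<in> {x_hat t w (alpha_of t w x)..x_check t w (alpha_of t w x)}"
    unfolding alpha_of_def by blast+
qed

end

section \<open>Social optima as threshold flows\<close>

theorem theorem3p3:
  fixes t :: "'n::finite \<Rightarrow> real"
    and vb :: "'n \<Rightarrow> ereal"
    and f :: "'n \<Rightarrow> real \<Rightarrow> real"
    and x :: real
    and v :: "'n \<Rightarrow> real"
  defines "w \<equiv> \<lambda>i. inv_flow (vb i) (f i)"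
  defines "\<alpha> \<equiv> alpha_of t w x"
  assumes "\<And>i. 0 \<le> t i"
    and "\<And>i. 0 < vb i"
    and "\<And>i. effective_frequency (vb i) (f i)"
    and "\<And>i. C2_on {0<..} (w i)"
    and "\<And>i. strictly_concave_on {0..} (w i)"
    and "0 < x" and "ereal x < (\<Sum>i\<in>UNIV. vb i)"
    and "\<And>i. v i \<in> flow_range (vb i)"
    and "(\<Sum>i\<in>UNIV. v i) = x"
  shows "social_optimum_line_flow t vb f x v \<longleftrightarrow>
    (\<forall>i. (t i > lambda_bar t w \<alpha> \<longrightarrow> v i = 0) \<and>
         (t i < lambda_bar t w \<alpha> \<longrightarrow> v i = w i \<alpha>) \<and>
         (t i = lambda_bar t w \<alpha> \<longrightarrow> 0 \<le> v i \<and> v i \<le> w i \<alpha>))"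
proof -
  note vb = assms(4) and f = assms(5) and C2 = assms(6) and conc = assms(7)
    and x = assms(8,9) and v = assms(10,11)
  have w: "w i = inv_flow (vb i) (f i)" for i by (simp add: w_def)
  have diff: "(w i has_real_derivative deriv (w i) a) (at a)" if "0 < a" for i a
    using C2[of i] that unfolding C2_on_def
    by (auto simp: DERIV_deriv_iff_real_differentiable)
  have w_nonneg: "0 \<le> w i a" if "0 \<le> a" for i a
    unfolding w using inv_flow_nonneg[OF f vb that] .
  have tangent: "w i b < w i a + deriv (w i) a * (b - a)" if "0 < a" "0 \<le> b" "b \<noteq> a" for i a b
    using strictly_concave_below_tangent[OF conc diff[OF that(1)] that] .
  \<comment> \<open>Strict growth of \<open>w i\<close> from \<open>a\<close> to
    \<open>a + 1\<close> is compared with the tangent at \<open>a\<close>, whose rise over a unit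
    step is the derivative.\<close>
  have deriv_pos: "0 < deriv (w i) a" if "0 < a" for i a
  proof -
    have "w i a < w i (a + 1)"
      unfolding w using that by (intro inv_flow_strict_mono[OF f vb]) auto
    then show ?thesis using tangent[OF that, of "a + 1" i] that by simp
  qed
  interpret concave_flows t w
    using w_nonneg deriv_pos tangent by unfold_locales

  have w_0: "(w i \<longlongrightarrow> 0) (at_right 0)" for i
  proof (rule tendsto_sandwich)
    show "\<forall>\<^sub>F a in at_right 0. 0 \<le> w i a" "\<forall>\<^sub>F a in at_right 0. w i a \<le> a * f i 0"
      using eventually_at_right_less[of "0::real"]
      by (auto elim!: eventually_mono simp: w inv_flow_nonneg[OF f vb] inv_flow_le_linear[OF f vb])
    show "((\<lambda>a. a * f i 0) \<longlongrightarrow> 0) (at_right 0)"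
      by (rule tendsto_eq_intros refl)+ simp
  qed simp
  have w_large: "\<forall>\<^sub>F a in at_top. x < (\<Sum>i\<in>UNIV. w i a)"
  proof -
    obtain u where u: "\<And>i. u i \<in> flow_range (vb i)" "x < (\<Sum>i\<in>UNIV. u i)"
      using sum_lt_saturation[OF vb x] by blast
    have "\<forall>\<^sub>F a in at_top. \<forall>i. u i \<le> w i a"
      unfolding w by (intro eventually_all_finite eventually_inv_flow_ge[OF f vb u(1)])
    then show ?thesis
      by eventually_elim (meson sum_mono u(2) less_le_trans)
  qed
  have "\<exists>a>0. x \<in> {x_hat t w a..x_check t w a}"
  proof (rule alpha_exists)
    show "isCont (w i) a" if "0 < a" for i a using DERIV_isCont[OF diff[OF that]] .
    show "isCont (deriv (w i)) a" if "0 < a" for i a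
      using C1_differentiable_imp_continuous_on[of "deriv (w i)" "{0<..}"] C2[of i] that
      unfolding C2_on_def by (simp add: continuous_on_eq_continuous_at)
    show "\<forall>\<^sub>F a in at_top. w i a < e * a" if "0 < e" for i e
      unfolding w using eventually_inv_flow_sublinear[OF f vb that] .
  qed (use w_0 w_large x in auto)
  then have \<alpha>: "0 < \<alpha>" "x \<in> {x_hat t w \<alpha>..x_check t w \<alpha>}"
    unfolding \<alpha>_def using alpha_of_works by blast+

  \<comment> \<open>The expected wait of \<open>h\<close> serves as the competing parameter
    \<open>b\<close>; the ratio bounds become \<open>u i \<le> w i b\<close>, so duality applies to
    the induced flow.\<close>
  have lower: "(\<Sum>i\<in>UNIV. t i * y i) + \<alpha> \<le> total_cost t vb f h"
    and equal: "total_cost t vb f h \<le> (\<Sum>i\<in>UNIV. t i * y i) + \<alpha> \<Longrightarrow>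
      threshold_flow t w \<alpha> (line_flow vb f h)"
    if y: "threshold_flow t w \<alpha> y" "(\<Sum>i\<in>UNIV. y i) = x" and h: "feasible vb f x h" for y h
  proof -
    obtain u where u: "induces_line_flow vb f h u" "line_flow vb f h = u" "(\<Sum>i\<in>UNIV. u i) = x"
      "total_cost t vb f h = (\<Sum>i\<in>UNIV. t i * u i) + expected_wait f h u"
      "0 \<le> expected_wait f h u" "\<And>i. u i / f i (u i) \<le> expected_wait f h u"
      using feasible_cost[OF f h] by blast
    have ur: "u i \<in> flow_range (vb i)" for i using induces_line_flow_range[OF f u(1)] .
    have "u i \<le> w i (expected_wait f h u)" for i
      unfolding w using le_inv_flow_iff[OF f vb ur u(5)] u(6) by blast
    note opt = threshold_flow_optimal[OF \<alpha>(1) y u(5) flow_rangeD[OF ur] this u(3)]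
    show "(\<Sum>i\<in>UNIV. t i * y i) + \<alpha> \<le> total_cost t vb f h"
      using opt(1) u(4) by simp
    show "threshold_flow t w \<alpha> (line_flow vb f h)"
      if "total_cost t vb f h \<le> (\<Sum>i\<in>UNIV. t i * y i) + \<alpha>"
      using opt(2) that u(2,4) by simp
  qed
  \<comment> \<open>The capacities \<open>w i \<alpha>\<close> lie in the flow ranges, hence so does
    \<open>y\<close>, and it obeys the ratio bound with \<open>m = \<alpha>\<close>.\<close>
  have attained: "\<exists>h. feasible vb f x h \<and> line_flow vb f h = y \<and>
      total_cost t vb f h \<le> (\<Sum>i\<in>UNIV. t i * y i) + \<alpha>"
    if y: "threshold_flow t w \<alpha> y" "(\<Sum>i\<in>UNIV. y i) = x" for y
  proof -
    have bounds: "0 \<le> y i" "y i \<le> w i \<alpha>" for i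
      using threshold_flow_bounds[OF \<alpha>(1) y(1)] by blast+
    have a: "0 \<le> \<alpha>" using \<alpha>(1) by simp
    have yr: "y i \<in> flow_range (vb i)" for i
      using flow_range_downward[OF inv_flow_in_range[OF f vb a] bounds(1)] bounds(2) unfolding w .
    have "y i / f i (y i) \<le> \<alpha>" for i
      using le_inv_flow_iff[OF f vb yr a] bounds(2) unfolding w by blast
    then show ?thesis using realise_line_flow[OF f yr y(2)] by blast
  qed
  have "social_optimum_line_flow t vb f x v \<longleftrightarrow> threshold_flow t w \<alpha> v"
  proof
    assume "social_optimum_line_flow t vb f x v"
    then obtain h where h: "feasible vb f x h" "v = line_flow vb f h"
        "\<And>h'. feasible vb f x h' \<Longrightarrow> total_cost t vb f h \<le> total_cost t vb f h'"
      unfolding social_optimum_line_flow_def social_optimum_def by blast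
    \<comment> \<open>Any threshold flow reveals the optimal value; an optimal \<open>h\<close>
      costs no more than its realisation, so the equality case applies to \<open>v\<close>.\<close>
    obtain y where y: "threshold_flow t w \<alpha> y" "(\<Sum>i\<in>UNIV. y i) = x"
      using threshold_flow_exists[OF \<alpha>] by blast
    obtain h' where h': "feasible vb f x h'" "total_cost t vb f h' \<le> (\<Sum>i\<in>UNIV. t i * y i) + \<alpha>"
      using attained[OF y] by blast
    show "threshold_flow t w \<alpha> v"
      using equal[OF y h(1)] h(3)[OF h'(1)] h'(2) h(2) by simp
  next
    assume thr: "threshold_flow t w \<alpha> v"
    obtain h where h: "feasible vb f x h" "line_flow vb f h = v"
        "total_cost t vb f h \<le> (\<Sum>i\<in>UNIV. t i * v i) + \<alpha>"
      using attained[OF thr v(2)] by blast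
    have "social_optimum t vb f x h"
      unfolding social_optimum_def using h(1,3) lower[OF thr v(2)] by (meson order_trans)
    then show "social_optimum_line_flow t vb f x v"
      unfolding social_optimum_line_flow_def using h(2) by blast
  qed
  then show ?thesis unfolding threshold_flow_def .
qed

end
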